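(* Let $\mathsf{K},\mathsf{L}$ be kernels on $S$. Then $\mathbf{D}_{\mathsf{L}}\mathsf{K}$ is $\mathbf{D}_{\mathsf{K}}\mathsf{L}$-almost dominated and, by symmetry, $\mathbf{D}_{\mathsf{K}}\mathsf{L}$ is $\mathbf{D}_{\mathsf{L}}\mathsf{K}$-almost dominated.
   Context: Let $S$ be a non-empty set and $\mathfrak{E}$ a complex Banach space with topological dual $\mathfrak{E}^{*}$. The dual pairing $\langle\cdot,\cdot\rangle:\mathfrak{E}\times\mathfrak{E}^{*}\to\mathbb{C}$ is taken linear in the first and conjugate linear in the second variable (the vector space structure of $\mathfrak{E}^*$ is chosen accordingly). $\mathbf{B}(\mathfrak{E},\mathfrak{E}^{*})$ is the space of bounded linear operators from $\mathfrak{E}$ to $\mathfrak{E}^*$. $\mathfrak{X}$ is the complex linear space of finitely supported functions $f:S\to\mathfrak{E}$. A kernel on $S$ is a function $\mathsf{K}:S\times S\to\mathbf{B}(\mathfrak{E},\mathfrak{E}^{*})$ with $\sum_{s,t\in S}\langle f(t),\mathsf{K}(s,t)f(s)\rangle\ge0$ for all $f\in\mathfrak{X}$. A form on $\mathfrak{X}$ is a map $\mathfrak{t}:\mathfrak{X}\times\mathfrak{X}\to\mathbb{C}$, linear in the first and antilinear in the second argument, with $\mathfrak{t}[x]:=\mathfrak{t}(x,x)\ge0$ for all $x$. Write $\mathfrak{t}\le\mathfrak{w}$ if $\mathfrak{t}[x]\le\mathfrak{w}[x]$ for all $x$; $\mathfrak{t}$ is dominated by $\mathfrak{w}$ if $\mathfrak{t}\le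 c\,\mathfrak{w}$ for some constant $c$; $\mathfrak{t}$ is almost dominated by $\mathfrak{w}$ if there is a monotonically nondecreasing sequence of forms $\mathfrak{t}_n$, each dominated by $\mathfrak{w}$, with $\mathfrak{t}=\sup_n\mathfrak{t}_n$ (pointwise supremum of quadratic forms). The parallel sum of forms is the form given by $(\mathfrak{t}:\mathfrak{w})[x]=\inf_{y\in\mathfrak{X}}\{\mathfrak{t}[x-y]+\mathfrak{w}[y]\}$, and $\mathbf{D}_{\mathfrak{w}}\mathfrak{t}:=\sup_{n\in\mathbb{N}}(\mathfrak{t}:n\mathfrak{w})$ (pointwise supremum), which is a form with $\mathbf{D}_{\mathfrak{w}}\mathfrak{t}\le\mathfrak{t}$. The form associated with a kernel $\mathsf{K}$ is $\mathfrak{w}_{\mathsf{K}}(f,g)=\sum_{s,t\in S}\langle f(t),\mathsf{K}(s,t)g(s)\rangle$. Every form $\mathfrak{w}\le\mathfrak{w}_{\mathsf{K}}$ is the associated form of a unique kernel; $\mathbf{D}_{\mathsf{L}}\mathsf{K}$ denotes the unique kernel whose associated form is $\mathbf{D}_{\mathfrak{w}_{\mathsf{L}}}\mathfrak{w}_{\mathsf{K}}$. A kernel $\mathsf{K}$ is $\mathsf{L}$-almost dominated if $\mathfrak{w}_{\mathsf{K}}$ is almost dominated by $\mathfrak{w}_{\mathsf{L}}$. *)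

theory Defs
  imports
    "HOL-Analysis.Bounded_Linear_Function"
    "HOL-Library.Nonpos_Ints"
    "HOL-Library.Poly_Mapping"
begin

section \<open>Complex Banach spaces\<close>

class scaleC =
  fixes scaleC :: "complex \<Rightarrow> 'a \<Rightarrow> 'a" (infixr \<open>*\<^sub>C\<close> 75)

class complex_vector = scaleC + ab_group_add +
  assumes scaleC_add_right: "a *\<^sub>C (x + y) = a *\<^sub>C x + a *\<^sub>C y"
    and scaleC_add_left: "(a + b) *\<^sub>C x = a *\<^sub>C x + b *\<^sub>C x"
    and scaleC_scaleC: "a *\<^sub>C (b *\<^sub>C x) = (a * b) *\<^sub>C x"
    and scaleC_one: "1 *\<^sub>C x = x"

class complex_normed_vector = complex_vector + real_normed_vector +
  assumes scaleC_of_real: "complex_of_real r *\<^sub>C x = r *\<^sub>R x"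
    and norm_scaleC: "norm (a *\<^sub>C x) = cmod a * norm x"

class complex_banach = complex_normed_vector + complete_space

definition bounded_clinear ::
    "('a::complex_normed_vector \<Rightarrow> 'b::complex_normed_vector) \<Rightarrow> bool" where
  "bounded_clinear T \<longleftrightarrow> bounded_linear T \<and> (\<forall>c x. T (c *\<^sub>C x) = c *\<^sub>C T x)"


section \<open>The topological dual\<close>

typedef (overloaded) ('a::complex_normed_vector) cdual =
    "{\<phi> :: 'a \<Rightarrow>\<^sub>L complex. \<forall>c x. blinfun_apply \<phi> (c *\<^sub>C x) = c * blinfun_apply \<phi> x}"
  by (rule exI[of _ 0]) simp

setup_lifting type_definition_cdual

lift_definition pairing :: "'a::complex_normed_vector \<Rightarrow> 'a cdual \<Rightarrow> complex"
  is "\<lambda>x \<phi>. blinfun_apply \<phi> x" .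

text \<open>The elements of the dual are the bounded \<^emph>\<open>linear\<close> functionals, but the scalar
  multiplication is twisted by complex conjugation, which makes the pairing conjugate linear in
  its second argument. The norm is the operator norm.\<close>

instantiation cdual :: (complex_normed_vector) complex_normed_vector
begin

lift_definition zero_cdual :: "'a cdual" is 0 by simp

lift_definition plus_cdual :: "'a cdual \<Rightarrow> 'a cdual \<Rightarrow> 'a cdual" is "(+)"
  by (simp add: blinfun.add_left algebra_simps)

lift_definition minus_cdual :: "'a cdual \<Rightarrow> 'a cdual \<Rightarrow> 'a cdual" is "(-)"
  by (simp add: blinfun.diff_left algebra_simps)

lift_definition uminus_cdual :: "'a cdual \<Rightarrow> 'a cdual" is "uminus"
  by (simp add: blinfun.minus_left)

lift_definition scaleR_cdual :: "real \<Rightarrow> 'a cdual \<Rightarrow> 'a cdual" is "(*\<^sub>R)"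
  by (simp add: blinfun.scaleR_left)

lift_definition scaleC_cdual :: "complex \<Rightarrow> 'a cdual \<Rightarrow> 'a cdual"
  is "\<lambda>c \<phi>. blinfun_compose (blinfun_mult_right (cnj c)) \<phi>"
  by (simp add: algebra_simps)

lift_definition norm_cdual :: "'a cdual \<Rightarrow> real" is norm .

definition dist_cdual :: "'a cdual \<Rightarrow> 'a cdual \<Rightarrow> real"
  where "dist_cdual \<phi> \<psi> = norm (\<phi> - \<psi>)"

definition sgn_cdual :: "'a cdual \<Rightarrow> 'a cdual"
  where "sgn_cdual \<phi> = inverse (norm \<phi>) *\<^sub>R \<phi>"

definition uniformity_cdual :: "('a cdual \<times> 'a cdual) filter"
  where "uniformity_cdual = (INF e\<in>{0<..}. principal {(\<phi>, \<psi>). dist \<phi> \<psi> < e})"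

definition open_cdual :: "'a cdual set \<Rightarrow> bool"
  where "open_cdual U = (\<forall>\<phi>\<in>U. \<forall>\<^sub>F (\<phi>', \<psi>) in uniformity. \<phi>' = \<phi> \<longrightarrow> \<psi> \<in> U)"

instance
proof
  fix \<phi> \<psi> \<xi> :: "'a cdual" and a b :: complex and r s :: real
  show "\<phi> + \<psi> + \<xi> = \<phi> + (\<psi> + \<xi>)" by transfer simp
  show "\<phi> + \<psi> = \<psi> + \<phi>" by transfer simp
  show "0 + \<phi> = \<phi>" by transfer simp
  show "- \<phi> + \<phi> = 0" by transfer simp
  show "\<phi> - \<psi> = \<phi> + - \<psi>" by transfer simp
  show "a *\<^sub>C (\<phi> + \<psi>) = a *\<^sub>C \<phi> + a *\<^sub>C \<psi>"
    by transfer (auto intro!: blinfun_eqI simp: blinfun.bilinear_simps algebra_simps)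
  show "(a + b) *\<^sub>C \<phi> = a *\<^sub>C \<phi> + b *\<^sub>C \<phi>"
    by transfer (auto intro!: blinfun_eqI simp: blinfun.bilinear_simps algebra_simps)
  show "a *\<^sub>C (b *\<^sub>C \<phi>) = (a * b) *\<^sub>C \<phi>"
    by transfer (auto intro!: blinfun_eqI simp: blinfun.bilinear_simps algebra_simps)
  show "1 *\<^sub>C \<phi> = \<phi>"
    by transfer (auto intro!: blinfun_eqI)
  show "r *\<^sub>R (\<phi> + \<psi>) = r *\<^sub>R \<phi> + r *\<^sub>R \<psi>" by transfer (simp add: algebra_simps)
  show "(r + s) *\<^sub>R \<phi> = r *\<^sub>R \<phi> + s *\<^sub>R \<phi>" by transfer (simp add: algebra_simps)
  show "r *\<^sub>R s *\<^sub>R \<phi> = (r * s) *\<^sub>R \<phi>" by transfer simp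
  show "1 *\<^sub>R \<phi> = \<phi>" by transfer simp
  show "dist \<phi> \<psi> = norm (\<phi> - \<psi>)" by (rule dist_cdual_def)
  show "sgn \<phi> = inverse (norm \<phi>) *\<^sub>R \<phi>" by (rule sgn_cdual_def)
  show "uniformity = (INF e\<in>{0<..}. principal {(\<phi>::'a cdual, \<psi>). dist \<phi> \<psi> < e})"
    by (rule uniformity_cdual_def)
  show "open U = (\<forall>\<phi>\<in>U. \<forall>\<^sub>F (\<phi>', \<psi>) in uniformity. \<phi>' = \<phi> \<longrightarrow> \<psi> \<in> U)" for U :: "'a cdual set"
    by (rule open_cdual_def)
  show "norm \<phi> = 0 \<longleftrightarrow> \<phi> = 0" by transfer simp
  show "norm (\<phi> + \<psi>) \<le> norm \<phi> + norm \<psi>" by transfer (rule norm_triangle_ineq)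
  show "norm (r *\<^sub>R \<phi>) = \<bar>r\<bar> * norm \<phi>" by transfer simp
  show "complex_of_real r *\<^sub>C \<phi> = r *\<^sub>R \<phi>"
    by transfer (auto intro!: blinfun_eqI simp: blinfun.bilinear_simps scaleR_conv_of_real)
  show "norm (a *\<^sub>C \<phi>) = cmod a * norm \<phi>"
  proof transfer
    fix a :: complex and \<phi> :: "'a \<Rightarrow>\<^sub>L complex"
    have le: "norm (blinfun_compose (blinfun_mult_right (cnj c)) \<xi>) \<le> cmod c * norm \<xi>"
      for c and \<xi> :: "'a \<Rightarrow>\<^sub>L complex"
    proof (rule norm_blinfun_bound)
      show "norm (blinfun_apply (blinfun_compose (blinfun_mult_right (cnj c)) \<xi>) x)
          \<le> cmod c * norm \<xi> * norm x" for x
        using mult_left_mono[OF norm_blinfun[of \<xi> x], of "cmod c"]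
        by (simp add: norm_mult mult.assoc)
    qed simp
    show "norm (blinfun_compose (blinfun_mult_right (cnj a)) \<phi>) = cmod a * norm \<phi>"
    proof (cases "a = 0")
      case True
      then show ?thesis using le[of a \<phi>] by simp
    next
      case False
      define \<psi> where "\<psi> = blinfun_compose (blinfun_mult_right (cnj a)) \<phi>"
      have "blinfun_compose (blinfun_mult_right (cnj (inverse a))) \<psi> = \<phi>"
        unfolding \<psi>_def using False by (auto intro!: blinfun_eqI)
      with le[of "inverse a" \<psi>] have "norm \<phi> \<le> cmod (inverse a) * norm \<psi>"
        by simp
      then have "cmod a * norm \<phi> \<le> norm \<psi>"
        using False by (simp add: norm_inverse norm_divide field_simps)
      with le[of a \<phi>] show ?thesis by (simp add: \<psi>_def)
    qed
  qed
qed

end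


section \<open>Finitely supported functions\<close>

instantiation poly_mapping :: (type, complex_vector) complex_vector
begin

lift_definition scaleC_poly_mapping :: "complex \<Rightarrow> ('a \<Rightarrow>\<^sub>0 'b) \<Rightarrow> ('a \<Rightarrow>\<^sub>0 'b)"
  is "\<lambda>c f s. c *\<^sub>C f s"
proof -
  fix c :: complex and f :: "'a \<Rightarrow> 'b"
  assume "finite {s. f s \<noteq> 0}"
  moreover have "c *\<^sub>C (0::'b) = 0"
    using scaleC_add_right[of c "0::'b" 0] by simp
  then have "{s. c *\<^sub>C f s \<noteq> 0} \<subseteq> {s. f s \<noteq> 0}" by auto
  ultimately show "finite {s. c *\<^sub>C f s \<noteq> 0}" by (rule rev_finite_subset)
qed

instance
  by standard
    (transfer, simp add: scaleC_add_right scaleC_add_left scaleC_scaleC scaleC_one fun_eq_iff)+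

end


section \<open>Forms\<close>

definition is_form :: "('x::complex_vector \<Rightarrow> 'x \<Rightarrow> complex) \<Rightarrow> bool" where
  "is_form t \<longleftrightarrow>
    (\<forall>x x' y. t (x + x') y = t x y + t x' y) \<and>
    (\<forall>c x y. t (c *\<^sub>C x) y = c * t x y) \<and>
    (\<forall>x y y'. t x (y + y') = t x y + t x y') \<and>
    (\<forall>c x y. t x (c *\<^sub>C y) = cnj c * t x y) \<and>
    (\<forall>x. t x x \<in> \<real>\<^sub>\<ge>\<^sub>0)"

text \<open>The quadratic form; for forms the diagonal values are real.\<close>
definition quad :: "('x \<Rightarrow> 'x \<Rightarrow> complex) \<Rightarrow> 'x \<Rightarrow> real" where
  "quad t x = Re (t x x)"

definition form_le :: "('x \<Rightarrow> 'x \<Rightarrow> complex) \<Rightarrow> ('x \<Rightarrow> 'x \<Rightarrow> complex) \<Rightarrow> bool" where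
  "form_le t w \<longleftrightarrow> (\<forall>x. quad t x \<le> quad w x)"

definition form_scale :: "real \<Rightarrow> ('x \<Rightarrow> 'x \<Rightarrow> complex) \<Rightarrow> 'x \<Rightarrow> 'x \<Rightarrow> complex" where
  "form_scale c w x y = complex_of_real c * w x y"

definition dominated :: "('x \<Rightarrow> 'x \<Rightarrow> complex) \<Rightarrow> ('x \<Rightarrow> 'x \<Rightarrow> complex) \<Rightarrow> bool" where
  "dominated t w \<longleftrightarrow> (\<exists>c. form_le t (form_scale c w))"

text \<open>Boundedness is required explicitly because \<^const>\<open>Sup\<close> on the reals is unspecified on
  unbounded sets.\<close>
definition is_form_sup ::
    "('x \<Rightarrow> 'x \<Rightarrow> complex) \<Rightarrow> (nat \<Rightarrow> 'x \<Rightarrow> 'x \<Rightarrow> complex) \<Rightarrow> bool" where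
  "is_form_sup t ts \<longleftrightarrow>
    (\<forall>x. bdd_above (range (\<lambda>n. quad (ts n) x)) \<and> quad t x = (SUP n. quad (ts n) x))"

definition almost_dominated ::
    "('x::complex_vector \<Rightarrow> 'x \<Rightarrow> complex) \<Rightarrow> ('x \<Rightarrow> 'x \<Rightarrow> complex) \<Rightarrow> bool" where
  "almost_dominated t w \<longleftrightarrow>
    (\<exists>ts. (\<forall>n. is_form (ts n)) \<and> (\<forall>n. form_le (ts n) (ts (Suc n))) \<and>
      (\<forall>n. dominated (ts n) w) \<and> is_form_sup t ts)"

text \<open>A form is determined by its quadratic form (polarization), so the definite descriptions
  below single out at most one form.\<close>

definition parallel_sum ::
    "('x::complex_vector \<Rightarrow> 'x \<Rightarrow> complex) \<Rightarrow> ('x \<Rightarrow> 'x \<Rightarrow> complex) \<Rightarrow> ('x \<Rightarrow> 'x \<Rightarrow> complex)" where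
  "parallel_sum t w =
    (THE p. is_form p \<and> (\<forall>x. quad p x = (INF y. quad t (x - y) + quad w y)))"

definition form_D ::
    "('x::complex_vector \<Rightarrow> 'x \<Rightarrow> complex) \<Rightarrow> ('x \<Rightarrow> 'x \<Rightarrow> complex) \<Rightarrow> ('x \<Rightarrow> 'x \<Rightarrow> complex)" where
  "form_D w t =
    (THE d. is_form d \<and> is_form_sup d (\<lambda>n. parallel_sum t (form_scale (real n) w)))"


section \<open>Kernels\<close>

text \<open>The index set is the whole type \<open>'s\<close>. The double sum over it is finite: \<open>K s t\<close> is linear
  and the pairing is biadditive, so the terms outside the supports vanish.\<close>
definition kernel_form ::
    "('s \<Rightarrow> 's \<Rightarrow> 'e::complex_normed_vector \<Rightarrow> 'e cdual) \<Rightarrow>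
     ('s \<Rightarrow>\<^sub>0 'e) \<Rightarrow> ('s \<Rightarrow>\<^sub>0 'e) \<Rightarrow> complex" where
  "kernel_form K f g =
    (\<Sum>s\<in>Poly_Mapping.keys g. \<Sum>t\<in>Poly_Mapping.keys f.
      pairing (Poly_Mapping.lookup f t) (K s t (Poly_Mapping.lookup g s)))"

definition is_kernel ::
    "('s \<Rightarrow> 's \<Rightarrow> 'e::complex_normed_vector \<Rightarrow> 'e cdual) \<Rightarrow> bool" where
  "is_kernel K \<longleftrightarrow>
    (\<forall>s t. bounded_clinear (K s t)) \<and> (\<forall>f. kernel_form K f f \<in> \<real>\<^sub>\<ge>\<^sub>0)"

definition kernel_D ::
    "('s \<Rightarrow> 's \<Rightarrow> 'e::complex_normed_vector \<Rightarrow> 'e cdual) \<Rightarrow>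
     ('s \<Rightarrow> 's \<Rightarrow> 'e \<Rightarrow> 'e cdual) \<Rightarrow> ('s \<Rightarrow> 's \<Rightarrow> 'e \<Rightarrow> 'e cdual)" where
  "kernel_D L K =
    (THE M. is_kernel M \<and> kernel_form M = form_D (kernel_form L) (kernel_form K))"

text \<open>The notion is one for kernels, hence the first two conjuncts.\<close>
definition kernel_almost_dominated ::
    "('s \<Rightarrow> 's \<Rightarrow> 'e::complex_normed_vector \<Rightarrow> 'e cdual) \<Rightarrow>
     ('s \<Rightarrow> 's \<Rightarrow> 'e \<Rightarrow> 'e cdual) \<Rightarrow> bool" where
  "kernel_almost_dominated K L \<longleftrightarrow>
    is_kernel K \<and> is_kernel L \<and> almost_dominated (kernel_form K) (kernel_form L)"

end

theory Submission
  imports Defs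
begin

text \<open>The forms \<open>t : n w\<close> increase to \<open>D\<^sub>w t\<close>. Since the parallel sum is symmetric,
  \<open>t : n w = n w : t \<le> n (w : t) \<le> n D\<^sub>t w\<close> for \<open>n \<ge> 1\<close>, so each of them is dominated by
  \<open>D\<^sub>t w\<close>. That the infima and suprema involved are quadratic forms at all is
  the Jordan--von Neumann theorem, and the resulting forms come from kernels because they lie below
  the form of a kernel, which makes them bounded on functions supported at one point.\<close>

section \<open>Complex vector spaces\<close>

lemma scaleC_zero_right [simp]: "c *\<^sub>C (0::'a::complex_vector) = 0"
  using scaleC_add_right[of c "0::'a" 0] by simp

lemma scaleC_zero_left [simp]: "0 *\<^sub>C (x::'a::complex_vector) = 0"
  using scaleC_add_left[of 0 0 x] by simp

lemma scaleC_minus_left: "(- c) *\<^sub>C (x::'a::complex_vector) = - (c *\<^sub>C x)"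
  using scaleC_add_left[of c "- c" x] by (simp add: eq_neg_iff_add_eq_0 add.commute)

lemma scaleC_minus_right: "c *\<^sub>C (- x::'a::complex_vector) = - (c *\<^sub>C x)"
  using scaleC_add_right[of c x "- x"] by (simp add: eq_neg_iff_add_eq_0 add.commute)

lemma scaleC_diff_right: "c *\<^sub>C (x - y::'a::complex_vector) = c *\<^sub>C x - c *\<^sub>C y"
  using scaleC_add_right[of c x "- y"] by (simp add: scaleC_minus_right)

section \<open>Forms and their quadratic forms\<close>

lemma
  assumes "is_form t"
  shows form_add_left: "t (x + x') y = t x y + t x' y"
    and form_scaleC_left: "t (c *\<^sub>C x) y = c * t x y"
    and form_add_right: "t x (y + y') = t x y + t x y'"
    and form_scaleC_right: "t x (c *\<^sub>C y) = cnj c * t x y"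
    and form_diag: "t x x \<in> \<real>\<^sub>\<ge>\<^sub>0"
  using assms by (auto simp: is_form_def)

lemma form_minus_left: "is_form t \<Longrightarrow> t (- x) y = - t x y"
  using form_scaleC_left[of t "-1" x y] by (simp add: scaleC_minus_left scaleC_one)

lemma form_minus_right: "is_form t \<Longrightarrow> t x (- y) = - t x y"
  using form_scaleC_right[of t x "-1" y] by (simp add: scaleC_minus_left scaleC_one)

lemma form_diff_left: "is_form t \<Longrightarrow> t (x - x') y = t x y - t x' y"
  using form_add_left[of t x "- x'" y] by (simp add: form_minus_left)

lemma form_diff_right: "is_form t \<Longrightarrow> t x (y - y') = t x y - t x y'"
  using form_add_right[of t x y "- y'"] by (simp add: form_minus_right)

lemma form_zero_left: "is_form t \<Longrightarrow> t 0 y = 0"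
  using form_add_left[of t 0 0 y] by simp

lemma form_zero_right: "is_form t \<Longrightarrow> t x 0 = 0"
  using form_add_right[of t x 0 0] by simp

lemma form_sum_left: "is_form t \<Longrightarrow> t (sum f A) y = (\<Sum>i\<in>A. t (f i) y)"
  by (induction A rule: infinite_finite_induct) (auto simp: form_zero_left form_add_left)

lemma form_sum_right: "is_form t \<Longrightarrow> t x (sum f A) = (\<Sum>i\<in>A. t x (f i))"
  by (induction A rule: infinite_finite_induct) (auto simp: form_zero_right form_add_right)

lemmas form_simps = form_add_left form_scaleC_left form_add_right form_scaleC_right
  form_minus_left form_minus_right form_diff_left form_diff_right form_zero_left form_zero_right

lemma form_diag_eq: "is_form t \<Longrightarrow> t x x = complex_of_real (quad t x)"
  using form_diag[of t x] by (auto simp: quad_def complex_nonneg_Reals_iff complex_eq_iff)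

lemma quad_nonneg: "is_form t \<Longrightarrow> 0 \<le> quad t x"
  using form_diag[of t x] by (auto simp: quad_def complex_nonneg_Reals_iff)

lemma quad_scaleC:
  assumes "is_form t"
  shows "quad t (c *\<^sub>C x) = (cmod c)\<^sup>2 * quad t x"
proof -
  have "t (c *\<^sub>C x) (c *\<^sub>C x) = (c * cnj c) * t x x"
    by (simp add: form_scaleC_left[OF assms] form_scaleC_right[OF assms])
  also have "\<dots> = complex_of_real ((cmod c)\<^sup>2 * quad t x)"
    by (simp add: form_diag_eq[OF assms] complex_norm_square[symmetric])
  finally show ?thesis unfolding quad_def by (simp only: Re_complex_of_real)
qed

lemma quad_parallelogram:
  assumes "is_form t"
  shows "quad t (x + y) + quad t (x - y) = 2 * quad t x + 2 * quad t y"
  by (simp add: quad_def form_simps[OF assms])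

lemma quad_zero: "is_form t \<Longrightarrow> quad t 0 = 0"
  by (simp add: quad_def form_zero_left)

lemma form_polarization:
  assumes "is_form t"
  shows "4 * t x y = of_real (quad t (x + y)) - of_real (quad t (x - y))
    + \<i> * of_real (quad t (x + \<i> *\<^sub>C y)) - \<i> * of_real (quad t (x - \<i> *\<^sub>C y))"
  unfolding form_diag_eq[OF assms, symmetric] by (simp add: form_simps[OF assms] algebra_simps)

text \<open>Polarization gives uniqueness for the definite descriptions \<open>parallel_sum\<close>
  and \<open>form_D\<close>.\<close>

lemma form_eqI:
  assumes "is_form t" "is_form t'" "\<And>x. quad t x = quad t' x"
  shows "t = t'"
proof (intro ext)
  fix x y
  have "4 * t x y = 4 * t' x y"
    by (simp only: form_polarization[OF assms(1)] form_polarization[OF assms(2)] assms(3))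
  then show "t x y = t' x y" by simp
qed

text \<open>Cauchy-Schwarz with the arithmetic mean in place of the geometric one; rescaling both
  vectors to norm 1 later turns it into a product bound. It follows from positivity at
  \<open>x - c *\<^sub>C y\<close> for a suitable phase \<open>c\<close>.\<close>

lemma cmod_form_le:
  assumes "is_form t"
  shows "2 * cmod (t x y) \<le> quad t x + quad t y"
proof -
  \<comment> \<open>The phase of \<open>t x y\<close>, so that rotating \<open>y\<close> by
    \<open>c\<close> makes the value real and nonnegative; any unimodular number serves when
    \<open>t x y = 0\<close>.\<close>
  define c where "c = (if t x y = 0 then 1 else t x y / of_real (cmod (t x y)))"
  have c: "cmod c = 1" "cnj c * t x y = of_real (cmod (t x y))"
    using complex_norm_square[of "t x y"]
    by (auto simp: c_def norm_divide power2_eq_square field_simps)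
  have nonneg: "0 \<le> quad t (x - c *\<^sub>C y)" by (rule quad_nonneg[OF assms])
  have "4 * Re (t x (c *\<^sub>C y)) = quad t (x + c *\<^sub>C y) - quad t (x - c *\<^sub>C y)"
    using arg_cong[OF form_polarization[OF assms, of x "c *\<^sub>C y"], of Re] by simp
  also have "\<dots> = 2 * quad t x + 2 * quad t (c *\<^sub>C y) - 2 * quad t (x - c *\<^sub>C y)"
    using quad_parallelogram[OF assms, of x "c *\<^sub>C y"] by simp
  also have "quad t (c *\<^sub>C y) = quad t y"
    using quad_scaleC[OF assms, of c y] c by simp
  finally show ?thesis
    using nonneg c by (simp add: form_simps[OF assms])
qed

lemma is_form_scale:
  assumes "is_form w" "0 \<le> c"
  shows "is_form (form_scale c w)"
  using assms
  unfolding is_form_def form_scale_def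
  by (auto simp: algebra_simps complex_nonneg_Reals_iff)

lemma quad_form_scale: "quad (form_scale c w) x = c * quad w x"
  by (simp add: quad_def form_scale_def)

section \<open>The Jordan-von Neumann theorem\<close>

text \<open>An additive function that is bounded near \<open>0\<close>: subtracting the linear part leaves a
  periodic, hence bounded, additive function.\<close>
lemma additive_bounded_imp_linear:
  fixes f :: "real \<Rightarrow> real"
  assumes add: "\<And>r s. f (r + s) = f r + f s"
    and bound: "\<And>r. 0 \<le> r \<Longrightarrow> r \<le> 1 \<Longrightarrow> \<bar>f r\<bar> \<le> M"
  shows "f r = r * f 1"
proof -
  define g where "g r = f r - r * f 1" for r
  have g_add: "g (r + s) = g r + g s" for r s
    by (simp add: g_def add algebra_simps)
  have g_nat: "g (real n * r) = real n * g r" for n r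
  proof (induction n)
    case 0
    show ?case using g_add[of 0 0] by simp
  next
    case (Suc n)
    then show ?case by (simp add: algebra_simps g_add)
  qed
  have g_minus: "g (- r) = - g r" for r
    using g_add[of r "- r"] g_add[of 0 0] by simp
  have g_one: "g 1 = 0" by (simp add: g_def)
  have g_int: "g (of_int k) = 0" for k
    using g_nat[of "nat k" 1] g_nat[of "nat (- k)" 1] g_minus[of "of_int (- k)"] g_one
    by (cases "k \<ge> 0") auto
  have g_bound: "\<bar>g r\<bar> \<le> M + \<bar>f 1\<bar>" for r
  proof -
    have "g r = g (frac r)"
      using g_add[of "of_int \<lfloor>r\<rfloor>" "frac r"] g_int by (simp add: frac_def)
    moreover have fr: "0 \<le> frac r" "frac r \<le> 1" by (auto simp: frac_lt_1 less_imp_le)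
    moreover have "\<bar>frac r * f 1\<bar> \<le> \<bar>f 1\<bar>"
      using mult_right_mono[OF fr(2), of "\<bar>f 1\<bar>"] by (simp add: abs_mult)
    ultimately show ?thesis
      using bound[OF fr] by (simp add: g_def)
  qed
  \<comment> \<open>A nonzero value of \<open>g\<close> would have integer multiples beyond any
    bound, and these are again values of \<open>g\<close>.\<close>
  have "g r = 0"
  proof (rule ccontr)
    assume "g r \<noteq> 0"
    then obtain n :: nat where "M + \<bar>f 1\<bar> < real n * \<bar>g r\<bar>"
      using reals_Archimedean3[of "\<bar>g r\<bar>"] by auto
    with g_bound[of "real n * r"] show False
      by (simp add: g_nat abs_mult)
  qed
  then show ?thesis by (simp add: g_def)
qed

text \<open>Jordan and von Neumann's theorem for seminorms; the inequalities assumed here imply the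
  corresponding equations.\<close>
lemma ex_form_of_quadratic:
  fixes Q :: "'x::complex_vector \<Rightarrow> real"
  assumes nonneg: "\<And>x. 0 \<le> Q x"
    and hom_le: "\<And>c x. Q (c *\<^sub>C x) \<le> (cmod c)\<^sup>2 * Q x"
    and par_le: "\<And>x y. Q (x + y) + Q (x - y) \<le> 2 * Q x + 2 * Q y"
  shows "\<exists>p. is_form p \<and> (\<forall>x. quad p x = Q x)"
proof -
  \<comment> \<open>The reverse inequality is \<open>hom_le\<close> for the scalar
    \<open>inverse c\<close> at the vector \<open>c *\<^sub>C x\<close>.\<close>
  have hom: "Q (c *\<^sub>C x) = (cmod c)\<^sup>2 * Q x" for c x
  proof (cases "c = 0")
    case True
    then show ?thesis using hom_le[of 0 x] nonneg[of 0] by simp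
  next
    case False
    have "Q x = Q (inverse c *\<^sub>C (c *\<^sub>C x))"
      using False by (simp add: scaleC_scaleC scaleC_one)
    also have "\<dots> \<le> (cmod (inverse c))\<^sup>2 * Q (c *\<^sub>C x)" by (rule hom_le)
    finally have "(cmod c)\<^sup>2 * Q x \<le> Q (c *\<^sub>C x)"
      using False by (simp add: norm_inverse power_inverse divide_inverse[symmetric] pos_le_divide_eq
          mult.commute)
    then show ?thesis using hom_le[of c x] by simp
  qed
  have Q_double: "Q (x + x) = 4 * Q x" for x
    using hom[of 2 x] scaleC_add_left[of 1 1 x] by (simp add: scaleC_one)
  \<comment> \<open>The reverse inequality is \<open>par_le\<close> at \<open>x + y\<close> and
    \<open>x - y\<close>, whose sum and difference are \<open>x + x\<close> and
    \<open>y + y\<close>.\<close>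
  have par: "Q (x + y) + Q (x - y) = 2 * Q x + 2 * Q y" for x y
    using par_le[of x y] par_le[of "x + y" "x - y"] Q_double[of x] Q_double[of y]
    by (simp add: algebra_simps)
  have Q_minus: "Q (- x) = Q x" for x
    using hom[of "-1" x] by (simp add: scaleC_minus_left scaleC_one)
  have Q_zero: "Q 0 = 0"
    using hom[of 0 0] by simp
  \<comment> \<open>By polarization, the real part of the form to be built.\<close>
  define B where "B x y = (Q (x + y) - Q (x - y)) / 4" for x y
  have sym: "B x y = B y x" for x y
    using Q_minus[of "x - y"] by (simp add: B_def add.commute)
  have minus: "B (- x) y = - B x y" for x y
    using Q_minus[of "x - y"] Q_minus[of "x + y"] by (simp add: B_def field_simps)
  have minus_right: "B x (- y) = - B x y" for x y
    using minus[of y x] by (simp add: sym[of x])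
  \<comment> \<open>Subtract the parallelogram law for \<open>x - y\<close> and \<open>x'\<close>
    from that for \<open>x + y\<close> and \<open>x'\<close>; the terms \<open>Q x'\<close>
    cancel.\<close>
  have sum_diff: "B (x + x') y + B (x - x') y = 2 * B x y" for x x' y
  proof -
    have eqs: "x + x' + y = x + y + x'" "x + x' - y = x - y + x'" "x - x' + y = x + y - x'"
      "x - x' - y = x - y - x'" by (simp_all add: algebra_simps)
    show ?thesis
      unfolding B_def eqs using par[of "x + y" x'] par[of "x - y" x'] by argo
  qed
  \<comment> \<open>Adding \<open>sum_diff\<close> to itself with \<open>x\<close> and
    \<open>x'\<close> exchanged cancels the differences, because \<open>B\<close> is odd in its
    first argument.\<close>
  have add: "B (x + x') y = B x y + B x' y" for x x' y
    using sum_diff[of x x' y] sum_diff[of x' x y] minus[of "x - x'" y]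
    by (simp add: algebra_simps)
  have B_bound: "\<bar>B x y\<bar> \<le> (Q x + Q y) / 2" for x y
    using par[of x y] nonneg[of "x + y"] nonneg[of "x - y"] by (simp add: B_def)
  have scaleR: "B (complex_of_real r *\<^sub>C x) y = r * B x y" for r x y
  proof -
    have "B (complex_of_real r *\<^sub>C x) y = r * B (complex_of_real 1 *\<^sub>C x) y"
    proof (rule additive_bounded_imp_linear)
      fix r s :: real
      show "B (complex_of_real (r + s) *\<^sub>C x) y
          = B (complex_of_real r *\<^sub>C x) y + B (complex_of_real s *\<^sub>C x) y"
        by (simp add: scaleC_add_left add)
      assume "0 \<le> r" "r \<le> 1"
      then have "r\<^sup>2 * Q x \<le> 1 * Q x"
        by (intro mult_right_mono nonneg) (simp add: power_le_one)
      then show "\<bar>B (complex_of_real r *\<^sub>C x) y\<bar> \<le> (Q x + Q y) / 2"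
        using B_bound[of "complex_of_real r *\<^sub>C x" y] hom[of "of_real r" x] by simp
    qed
    then show ?thesis by (simp add: scaleC_one)
  qed
  have B_ii: "B (\<i> *\<^sub>C x) (\<i> *\<^sub>C y) = B x y" for x y
    using hom[of \<i> "x + y"] hom[of \<i> "x - y"]
    by (simp add: B_def scaleC_add_right scaleC_diff_right)
  have ii: "\<i> *\<^sub>C \<i> *\<^sub>C x = - x" for x :: 'x
    by (simp add: scaleC_scaleC scaleC_minus_left scaleC_one)
  have B_i: "B (\<i> *\<^sub>C x) y = - B x (\<i> *\<^sub>C y)" for x y
    using B_ii[of "\<i> *\<^sub>C x" y] by (simp add: ii minus)
  \<comment> \<open>Antilinearity in the second argument forces p(x, i y) = -i p(x, y), whose real
    part is the imaginary part of p(x, y).\<close>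
  define p where "p x y = Complex (B x y) (B x (\<i> *\<^sub>C y))" for x y
  \<comment> \<open>Hermitian symmetry reduces the laws for the second argument to those for the
    first.\<close>
  have herm: "p y x = cnj (p x y)" for x y
    using sym[of x y] B_i[of y x] sym[of "\<i> *\<^sub>C y" x] by (simp add: p_def complex_eq_iff)
  have p_add: "p (x + x') y = p x y + p x' y" for x x' y
    by (simp add: p_def add complex_eq_iff)
  have p_real: "p (complex_of_real r *\<^sub>C x) y = of_real r * p x y" for r x y
    by (simp add: p_def scaleR complex_eq_iff)
  have p_i: "p (\<i> *\<^sub>C x) y = \<i> * p x y" for x y
    by (simp add: p_def B_i ii complex_eq_iff minus_right)
  have p_scaleC: "p (c *\<^sub>C x) y = c * p x y" for c x y
  proof -
    have c: "of_real (Re c) + of_real (Im c) * \<i> = c"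
      by (simp add: complex_eq_iff)
    have "c *\<^sub>C x = of_real (Re c) *\<^sub>C x + of_real (Im c) *\<^sub>C \<i> *\<^sub>C x"
      by (simp only: scaleC_scaleC scaleC_add_left[symmetric] c)
    then have "p (c *\<^sub>C x) y = (of_real (Re c) + of_real (Im c) * \<i>) * p x y"
      by (simp add: p_add p_real p_i algebra_simps)
    then show ?thesis by (simp only: c)
  qed
  \<comment> \<open>The imaginary part \<open>B x (\<i> *\<^sub>C x)\<close> equals its own negative
    by \<open>B_i\<close> and symmetry.\<close>
  have diag: "p x x = of_real (Q x)" for x
    using B_i[of x x] sym[of x "\<i> *\<^sub>C x"]
    by (simp add: p_def complex_eq_iff) (simp add: B_def Q_double Q_zero)
  have "is_form p"
    unfolding is_form_def
  proof (intro conjI allI)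
    show "p x (y + y') = p x y + p x y'" for x y y'
      using p_add[of y y' x] by (simp add: herm[of x])
    show "p x (c *\<^sub>C y) = cnj c * p x y" for c x y
      using p_scaleC[of c y x] by (simp add: herm[of x])
  qed (auto simp: p_add p_scaleC diag nonneg complex_nonneg_Reals_iff)
  moreover have "quad p x = Q x" for x
    by (simp add: quad_def diag)
  ultimately show ?thesis by blast
qed

section \<open>Parallel sums\<close>

lemma parallel_sum_bdd_below:
  assumes "is_form t" "is_form w"
  shows "bdd_below (range (\<lambda>y. quad t (x - y) + quad w y))"
  by (rule bdd_belowI[where m = 0]) (auto simp: assms quad_nonneg)

text \<open>Substituting competitors in the infimum yields the two inequalities that
  \<open>ex_form_of_quadratic\<close> asks for: \<open>c *\<^sub>C y\<close> for homogeneity,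
  \<open>y + y'\<close> and \<open>y - y'\<close> for the parallelogram law.\<close>

lemma parallel_sum:
  assumes t: "is_form t" and w: "is_form w"
  shows is_form_parallel_sum: "is_form (parallel_sum t w)"
    and quad_parallel_sum: "quad (parallel_sum t w) x = (INF y. quad t (x - y) + quad w y)"
proof -
  define Q where "Q x = (INF y. quad t (x - y) + quad w y)" for x
  have lower: "Q x \<le> quad t (x - y) + quad w y" for x y
    unfolding Q_def by (rule cINF_lower[OF parallel_sum_bdd_below[OF t w]]) simp
  have greatest: "a \<le> Q x" if "\<And>y. a \<le> quad t (x - y) + quad w y" for a x
    unfolding Q_def by (rule cINF_greatest) (auto simp: that)
  have "\<exists>p. is_form p \<and> (\<forall>x. quad p x = Q x)"
  proof (rule ex_form_of_quadratic)
    show "0 \<le> Q x" for x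
      by (rule greatest) (simp add: t w quad_nonneg)
    show "Q (c *\<^sub>C x) \<le> (cmod c)\<^sup>2 * Q x" for c x
    proof (cases "c = 0")
      case True
      then show ?thesis using lower[of 0 0] by (simp add: t w quad_zero)
    next
      case False
      have "Q (c *\<^sub>C x) / (cmod c)\<^sup>2 \<le> Q x"
      proof (rule greatest)
        fix y
        show "Q (c *\<^sub>C x) / (cmod c)\<^sup>2 \<le> quad t (x - y) + quad w y"
          using lower[of "c *\<^sub>C x" "c *\<^sub>C y"] False
          by (simp add: scaleC_diff_right[symmetric] quad_scaleC t w field_simps)
      qed
      then show ?thesis using False by (simp add: field_simps)
    qed
    show "Q (x + x') + Q (x - x') \<le> 2 * Q x + 2 * Q x'" for x x'
    proof -
      have le: "Q (x + x') + Q (x - x')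
          \<le> 2 * (quad t (x - y) + quad w y) + 2 * (quad t (x' - y') + quad w y')" for y y'
        using lower[of "x + x'" "y + y'"] lower[of "x - x'" "y - y'"]
          quad_parallelogram[OF t, of "x - y" "x' - y'"] quad_parallelogram[OF w, of y y']
        by (simp add: algebra_simps)
      \<comment> \<open>Rearranged so that the infimum over \<open>y'\<close> can be taken with
        \<open>y\<close> fixed; the infimum over \<open>y\<close> comes after it.\<close>
      have half: "(Q (x + x') + Q (x - x')) / 2 - (quad t (x - y) + quad w y)
          \<le> quad t (x' - y') + quad w y'" for y y'
        using le[of y y'] by argo
      have "(Q (x + x') + Q (x - x')) / 2 - (quad t (x - y) + quad w y) \<le> Q x'" for y
        by (rule greatest) (rule half)
      then have "(Q (x + x') + Q (x - x')) / 2 - Q x' \<le> Q x"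
        by (intro greatest) (simp add: field_simps)
      then show ?thesis by argo
    qed
  qed
  then have "\<exists>!p. is_form p \<and> (\<forall>x. quad p x = Q x)"
    by (metis form_eqI)
  from theI'[OF this[unfolded Q_def]]
  show "is_form (parallel_sum t w)"
    and "quad (parallel_sum t w) x = (INF y. quad t (x - y) + quad w y)"
    unfolding parallel_sum_def by auto
qed

lemma quad_parallel_sum_le:
  assumes "is_form t" "is_form w"
  shows "quad (parallel_sum t w) x \<le> quad t (x - y) + quad w y"
  unfolding quad_parallel_sum[OF assms]
  by (rule cINF_lower[OF parallel_sum_bdd_below[OF assms]]) simp

lemma le_quad_parallel_sum:
  assumes "is_form t" "is_form w" "\<And>y. a \<le> quad t (x - y) + quad w y"
  shows "a \<le> quad (parallel_sum t w) x"
  unfolding quad_parallel_sum[OF assms(1,2)] by (rule cINF_greatest) (auto simp: assms)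

lemma parallel_sum_mono_right:
  assumes "is_form t" "is_form w" "is_form w'" "form_le w w'"
  shows "form_le (parallel_sum t w) (parallel_sum t w')"
  unfolding form_le_def
proof (intro allI le_quad_parallel_sum assms)
  show "quad (parallel_sum t w) x \<le> quad t (x - y) + quad w' y" for x y
    using quad_parallel_sum_le[OF assms(1,2), of x y] assms(4) unfolding form_le_def
    by (meson add_left_mono order_trans)
qed

lemma parallel_sum_le_left:
  assumes "is_form t" "is_form w"
  shows "form_le (parallel_sum t w) t"
  unfolding form_le_def
  using quad_parallel_sum_le[OF assms, of _ 0] by (simp add: quad_zero assms)

text \<open>A splitting of \<open>x\<close> for \<open>w : t\<close>, with its two parts exchanged,
  is a splitting for \<open>t : n w\<close>, and t[y] + n w[x - y] is at most n (w[x - y] + t[y])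
  once n is at least 1.\<close>

lemma parallel_sum_scale_le:
  assumes t: "is_form t" and w: "is_form w"
  shows "form_le (parallel_sum t (form_scale (real n) w))
    (form_scale (real n) (parallel_sum w t))"
  unfolding form_le_def quad_form_scale
proof
  fix x
  have nw: "is_form (form_scale (real n) w)" using w by (rule is_form_scale) simp
  show "quad (parallel_sum t (form_scale (real n) w)) x \<le> real n * quad (parallel_sum w t) x"
  proof (cases "n = 0")
    \<comment> \<open>For \<open>n = 0\<close> all of \<open>x\<close> can be charged to the zero
      form, so the left side is at most 0.\<close>
    case True
    then show ?thesis
      using quad_parallel_sum_le[OF t nw, of x x] by (simp add: quad_zero quad_form_scale t)
  next
    case False
    have "quad (parallel_sum t (form_scale (real n) w)) x / real n \<le> quad (parallel_sum w t) x"
    proof (rule le_quad_parallel_sum[OF w t])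
      fix y
      have "quad t y \<le> real n * quad t y"
        using False mult_right_mono[of 1 "real n" "quad t y"] by (simp add: quad_nonneg t)
      then show "quad (parallel_sum t (form_scale (real n) w)) x / real n
          \<le> quad w (x - y) + quad t y"
        using quad_parallel_sum_le[OF t nw, of x "x - y"] False
        by (simp add: quad_form_scale field_simps)
    qed
    then show ?thesis using False by (simp add: field_simps)
  qed
qed

section \<open>Suprema of forms\<close>

text \<open>Monotonicity makes the supremum a pointwise limit, and homogeneity and the parallelogram
  law pass to limits.\<close>

lemma ex_form_sup:
  assumes ts: "\<And>n. is_form (ts n)" and mono: "\<And>n. form_le (ts n) (ts (Suc n))"
    and bound: "\<And>n. form_le (ts n) w"
  shows "\<exists>d. is_form d \<and> is_form_sup d ts"
proof -
  define Q where "Q x = (SUP n. quad (ts n) x)" for x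
  have bdd: "bdd_above (range (\<lambda>n. quad (ts n) x))" for x
    using bound unfolding form_le_def by (intro bdd_aboveI[where M = "quad w x"]) auto
  have lim: "(\<lambda>n. quad (ts n) x) \<longlonglongrightarrow> Q x" for x
    unfolding Q_def using mono
    by (intro LIMSEQ_incseq_SUP bdd incseq_SucI) (auto simp: form_le_def)
  have "\<exists>p. is_form p \<and> (\<forall>x. quad p x = Q x)"
  proof (rule ex_form_of_quadratic)
    show "0 \<le> Q x" for x
      by (rule LIMSEQ_le_const[OF lim]) (auto simp: quad_nonneg ts)
    show "Q (c *\<^sub>C x) \<le> (cmod c)\<^sup>2 * Q x" for c x
      using LIMSEQ_unique[OF lim[of "c *\<^sub>C x"]] tendsto_mult_left[OF lim[of x], of "(cmod c)\<^sup>2"]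
      by (simp add: quad_scaleC ts)
    show "Q (x + y) + Q (x - y) \<le> 2 * Q x + 2 * Q y" for x y
      using LIMSEQ_unique[OF tendsto_add[OF lim[of "x + y"] lim[of "x - y"]]]
        tendsto_add[OF tendsto_mult_left[OF lim[of x], of 2] tendsto_mult_left[OF lim[of y], of 2]]
      by (simp add: quad_parallelogram ts)
  qed
  then show ?thesis
    unfolding is_form_sup_def using bdd by (auto simp: Q_def)
qed

lemma is_form_sup_le:
  assumes "is_form_sup d ts"
  shows "form_le (ts n) d"
  using assms unfolding is_form_sup_def form_le_def by (auto intro: cSUP_upper2)

lemma is_form_sup_least:
  assumes "is_form_sup d ts" "\<And>n. form_le (ts n) w"
  shows "form_le d w"
  using assms unfolding is_form_sup_def form_le_def by (auto intro: cSUP_least)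

lemma parallel_sum_scale_mono:
  assumes "is_form t" "is_form w"
  shows "form_le (parallel_sum t (form_scale (real n) w))
    (parallel_sum t (form_scale (real (Suc n)) w))"
  using assms quad_nonneg[OF assms(2)]
  by (intro parallel_sum_mono_right is_form_scale)
    (auto simp: form_le_def quad_form_scale algebra_simps)

lemma form_D:
  assumes t: "is_form t" and w: "is_form w"
  shows is_form_form_D: "is_form (form_D w t)"
    and is_form_sup_form_D:
      "is_form_sup (form_D w t) (\<lambda>n. parallel_sum t (form_scale (real n) w))"
proof -
  let ?P = "\<lambda>d. is_form d \<and> is_form_sup d (\<lambda>n. parallel_sum t (form_scale (real n) w))"
  have "\<exists>d. ?P d"
    \<comment> \<open>The common upper bound is \<open>t\<close> itself, since every parallel sum
      \<open>t : n w\<close> lies below \<open>t\<close>.\<close>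
    by (rule ex_form_sup[of _ t])
      (auto intro!: is_form_parallel_sum parallel_sum_scale_mono parallel_sum_le_left is_form_scale
        t w simp del: of_nat_Suc)
  moreover have "d = d'" if "?P d" "?P d'" for d d'
    using that by (intro form_eqI) (auto simp: is_form_sup_def)
  ultimately have "\<exists>!d. ?P d" by blast
  from theI'[OF this] show "is_form (form_D w t)"
    "is_form_sup (form_D w t) (\<lambda>n. parallel_sum t (form_scale (real n) w))"
    unfolding form_D_def by auto
qed

lemma form_D_le:
  assumes "is_form t" "is_form w"
  shows "form_le (form_D w t) t"
  by (rule is_form_sup_least[OF is_form_sup_form_D[OF assms]])
    (simp add: parallel_sum_le_left is_form_scale assms)

lemma form_D_almost_dominated:
  assumes t: "is_form t" and w: "is_form w"
  shows "almost_dominated (form_D w t) (form_D t w)"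
  unfolding almost_dominated_def
proof (intro exI[of _ "\<lambda>n. parallel_sum t (form_scale (real n) w)"] conjI allI)
  fix n
  show "is_form (parallel_sum t (form_scale (real n) w))"
    by (simp add: is_form_parallel_sum is_form_scale t w)
  show "form_le (parallel_sum t (form_scale (real n) w))
      (parallel_sum t (form_scale (real (Suc n)) w))"
    by (rule parallel_sum_scale_mono[OF t w])
  \<comment> \<open>The member with index 1 of the sequence defining \<open>form_D t w\<close> is
    \<open>w : t\<close> itself, which therefore lies below the supremum.\<close>
  have "form_scale (real 1) t = t" by (simp add: form_scale_def fun_eq_iff)
  then have "form_le (parallel_sum w t) (form_D t w)"
    using is_form_sup_le[OF is_form_sup_form_D[OF w t], of 1] by simp
  then have "form_le (parallel_sum t (form_scale (real n) w)) (form_scale (real n) (form_D t w))"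
    using parallel_sum_scale_le[OF t w, of n] unfolding form_le_def quad_form_scale
    by (meson mult_left_mono of_nat_0_le_iff order_trans)
  then show "dominated (parallel_sum t (form_scale (real n) w)) (form_D t w)"
    unfolding dominated_def by blast
qed (rule is_form_sup_form_D[OF t w])

section \<open>Kernels and their forms\<close>

lemma pairing_add_left: "pairing (x + y) \<phi> = pairing x \<phi> + pairing y \<phi>"
  by transfer (simp add: blinfun.add_right)

lemma pairing_scaleC_left: "pairing (c *\<^sub>C x) \<phi> = c * pairing x \<phi>"
  by transfer simp

lemma pairing_add_right: "pairing x (\<phi> + \<psi>) = pairing x \<phi> + pairing x \<psi>"
  by transfer (simp add: blinfun.add_left)

lemma pairing_scaleC_right: "pairing x (c *\<^sub>C \<phi>) = cnj c * pairing x \<phi>"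
  by transfer simp

lemma pairing_zero_left [simp]: "pairing 0 \<phi> = 0"
  by transfer (simp add: blinfun.zero_right)

lemma pairing_zero_right [simp]: "pairing x 0 = 0"
  by transfer simp

lemma cmod_pairing_le: "cmod (pairing x \<phi>) \<le> norm \<phi> * norm x"
  by transfer (rule norm_blinfun)

lemma cdual_eqI: "(\<And>x. pairing x \<phi> = pairing x \<psi>) \<Longrightarrow> \<phi> = \<psi>"
  by transfer (rule blinfun_eqI)

lemma single_scaleC: "Poly_Mapping.single s (c *\<^sub>C x) = c *\<^sub>C Poly_Mapping.single s x"
  by transfer (auto simp: when_def)

lemma lookup_scaleC: "Poly_Mapping.lookup (c *\<^sub>C f) s = c *\<^sub>C Poly_Mapping.lookup f s"
  by transfer simp

lemma
  assumes "bounded_clinear T"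
  shows bounded_clinear_add: "T (x + y) = T x + T y"
    and bounded_clinear_scaleC: "T (c *\<^sub>C x) = c *\<^sub>C T x"
    and bounded_clinear_zero: "T 0 = 0"
  using assms unfolding bounded_clinear_def
  by (auto simp: linear_simps bounded_linear.linear linear_add linear_0)

text \<open>Enlarging the index sets only adds zero terms. This lets functions with different
  supports be summed over common sets when linearity is checked.\<close>

lemma kernel_form_eq_sum:
  assumes K: "\<And>s t. bounded_clinear (K s t)"
    and "finite A" "Poly_Mapping.keys f \<subseteq> A" "finite B" "Poly_Mapping.keys g \<subseteq> B"
  shows "kernel_form K f g =
    (\<Sum>s\<in>B. \<Sum>t\<in>A. pairing (Poly_Mapping.lookup f t) (K s t (Poly_Mapping.lookup g s)))"
proof -
  have "kernel_form K f g = (\<Sum>s\<in>Poly_Mapping.keys g. \<Sum>t\<in>A.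
      pairing (Poly_Mapping.lookup f t) (K s t (Poly_Mapping.lookup g s)))"
    unfolding kernel_form_def using assms
    by (intro sum.cong sum.mono_neutral_left) (auto simp: in_keys_iff)
  also have "\<dots> = (\<Sum>s\<in>B. \<Sum>t\<in>A.
      pairing (Poly_Mapping.lookup f t) (K s t (Poly_Mapping.lookup g s)))"
    using assms(4,5) bounded_clinear_zero[OF K]
    by (intro sum.mono_neutral_left) (auto simp: in_keys_iff)
  finally show ?thesis .
qed

text \<open>Functions supported at one point recover the entries of a kernel from its form;
  uniqueness of the kernel rests on this.\<close>

lemma kernel_form_single:
  assumes "\<And>s t. bounded_clinear (K s t)"
  shows "kernel_form K (Poly_Mapping.single t x) (Poly_Mapping.single s y) = pairing x (K s t y)"
  by (subst kernel_form_eq_sum[OF assms, where A = "{t}" and B = "{s}"])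
    auto

lemma is_form_kernel_form:
  assumes "is_kernel K"
  shows "is_form (kernel_form K)"
proof -
  have K: "bounded_clinear (K s t)" for s t
    using assms unfolding is_kernel_def by blast
  note simps = bounded_clinear_add[OF K] bounded_clinear_scaleC[OF K] lookup_add lookup_scaleC
    pairing_add_left pairing_add_right pairing_scaleC_left pairing_scaleC_right
    sum.distrib sum_distrib_left
  have scaleC_keys: "Poly_Mapping.keys (c *\<^sub>C f) \<subseteq> Poly_Mapping.keys f" for c and f :: "'a \<Rightarrow>\<^sub>0 'b"
    by (auto simp: in_keys_iff lookup_scaleC)
  let ?k = Poly_Mapping.keys
  show ?thesis
    unfolding is_form_def
  proof (intro conjI allI)
    fix f f' g g' :: "'a \<Rightarrow>\<^sub>0 'b" and c
    let ?A = "?k f \<union> ?k f'" and ?B = "?k g \<union> ?k g'"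
    have eq: "kernel_form K u v = (\<Sum>s\<in>?B. \<Sum>t\<in>?A.
        pairing (Poly_Mapping.lookup u t) (K s t (Poly_Mapping.lookup v s)))"
      if "?k u \<subseteq> ?A" "?k v \<subseteq> ?B" for u v
      using that by (intro kernel_form_eq_sum K) auto
    have sub: "?k (f + f') \<subseteq> ?A" "?k (g + g') \<subseteq> ?B" "?k (c *\<^sub>C f) \<subseteq> ?A" "?k (c *\<^sub>C g) \<subseteq> ?B"
      using keys_add[of f f'] keys_add[of g g'] scaleC_keys[of c] by auto
    show "kernel_form K (f + f') g = kernel_form K f g + kernel_form K f' g"
      by (simp add: eq sub simps)
    show "kernel_form K (c *\<^sub>C f) g = c * kernel_form K f g"
      by (simp add: eq sub simps)
    show "kernel_form K f (g + g') = kernel_form K f g + kernel_form K f g'"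
      by (simp add: eq sub simps)
    show "kernel_form K f (c *\<^sub>C g) = cnj c * kernel_form K f g"
      by (simp add: eq sub simps)
    show "kernel_form K f f \<in> \<real>\<^sub>\<ge>\<^sub>0"
      using assms unfolding is_kernel_def by blast
  qed
qed

lemma kernel_form_inject:
  assumes "is_kernel K" "is_kernel L" "kernel_form K = kernel_form L"
  shows "K = L"
proof (intro ext cdual_eqI)
  fix s t y x
  show "pairing x (K s t y) = pairing x (L s t y)"
    using assms kernel_form_single[of K t x s y] kernel_form_single[of L t x s y]
    unfolding is_kernel_def by simp
qed

section \<open>From dominated forms back to kernels\<close>

lemma ex_cdual:
  fixes g :: "'e::complex_normed_vector \<Rightarrow> complex"
  assumes "\<And>x y. g (x + y) = g x + g y" "\<And>c x. g (c *\<^sub>C x) = c * g x"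
    and "\<And>x. cmod (g x) \<le> C * norm x"
  shows "\<exists>\<phi>. \<forall>x. pairing x \<phi> = g x"
proof -
  have "bounded_linear g"
  proof (rule bounded_linear_intro)
    show "g (r *\<^sub>R x) = r *\<^sub>R g x" for r x
      using assms(2)[of "of_real r" x] by (simp add: scaleC_of_real scaleR_conv_of_real)
    show "norm (g x) \<le> norm x * C" for x
      using assms(3)[of x] by (simp add: mult.commute)
  qed (rule assms(1))
  then have "pairing x (Abs_cdual (Blinfun g)) = g x" for x
    by (simp add: pairing.rep_eq Abs_cdual_inverse bounded_linear_Blinfun_apply assms(2))
  then show ?thesis by blast
qed

lemma norm_cdual_le:
  assumes "\<And>x. cmod (pairing x \<phi>) \<le> C * norm x" "0 \<le> C"
  shows "norm \<phi> \<le> C"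
  using assms by transfer (rule norm_blinfun_bound)

text \<open>On the diagonal, \<open>d\<close> is controlled by the operator norms of
  \<open>K s s\<close> and \<open>K t t\<close>; \<open>cmod_form_le\<close> carries this over to
  mixed arguments.\<close>

lemma form_le_kernel_form_bound:
  fixes K :: "'s \<Rightarrow> 's \<Rightarrow> 'e::complex_normed_vector \<Rightarrow> 'e cdual"
  assumes K: "is_kernel K" and d: "is_form d" and le: "form_le d (kernel_form K)"
  shows "\<exists>C\<ge>0. \<forall>x y. cmod (d (Poly_Mapping.single t x) (Poly_Mapping.single s y))
    \<le> C * norm x * norm y"
proof -
  let ?S = Poly_Mapping.single
  have diag: "\<exists>C\<ge>0. \<forall>x. quad d (?S s x) \<le> C * (norm x)\<^sup>2" for s
  proof -
    have K': "bounded_clinear (K s t)" for s t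
      using K unfolding is_kernel_def by blast
    then obtain C where C: "C \<ge> 0" "\<And>x. norm (K s s x) \<le> norm x * C"
      unfolding bounded_clinear_def using bounded_linear.nonneg_bounded by blast
    have "quad d (?S s x) \<le> C * (norm x)\<^sup>2" for x
    proof -
      have "quad d (?S s x) \<le> Re (pairing x (K s s x))"
        using le kernel_form_single[where K = K, OF K', of s x s x]
        by (metis form_le_def quad_def)
      also have "\<dots> \<le> norm (K s s x) * norm x"
        using complex_Re_le_cmod cmod_pairing_le order_trans by blast
      also have "\<dots> \<le> (norm x * C) * norm x"
        by (intro mult_right_mono C) simp
      finally show ?thesis by (simp add: power2_eq_square mult_ac)
    qed
    with C(1) show ?thesis by blast
  qed
  obtain C D where C: "C \<ge> 0" "\<And>x. quad d (?S t x) \<le> C * (norm x)\<^sup>2"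
    and D: "D \<ge> 0" "\<And>x. quad d (?S s x) \<le> D * (norm x)\<^sup>2"
    using diag[of s] diag[of t] by metis
  have "cmod (d (?S t x) (?S s y)) \<le> (C + D) / 2 * norm x * norm y" for x y
  proof (cases "x = 0 \<or> y = 0")
    case True
    then show ?thesis by (auto simp: form_zero_left form_zero_right d)
  next
    case False
    \<comment> \<open>Normalizing both vectors turns the bound by a sum of squares into one by the
      product of the norms.\<close>
    define a b where "a = complex_of_real (inverse (norm x))"
      and "b = complex_of_real (inverse (norm y))"
    have unit: "norm (a *\<^sub>C x) = 1" "norm (b *\<^sub>C y) = 1"
      using False by (auto simp: norm_scaleC a_def b_def norm_inverse)
    have "2 * cmod (d (?S t (a *\<^sub>C x)) (?S s (b *\<^sub>C y))) \<le> C + D"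
      using cmod_form_le[OF d, of "?S t (a *\<^sub>C x)" "?S s (b *\<^sub>C y)"]
        C(2)[of "a *\<^sub>C x"] D(2)[of "b *\<^sub>C y"] unit by simp
    moreover have "cmod (d (?S t (a *\<^sub>C x)) (?S s (b *\<^sub>C y)))
        = inverse (norm x) * inverse (norm y) * cmod (d (?S t x) (?S s y))"
      by (simp add: single_scaleC form_simps[OF d] norm_mult norm_inverse a_def b_def)
    ultimately show ?thesis using False by (simp add: field_simps)
  qed
  with C(1) D(1) show ?thesis by (intro exI[of _ "(C + D) / 2"]) auto
qed

lemma sum_single_lookup:
  fixes f :: "'s \<Rightarrow>\<^sub>0 'e::comm_monoid_add"
  shows "(\<Sum>t\<in>Poly_Mapping.keys f. Poly_Mapping.single t (Poly_Mapping.lookup f t)) = f"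
proof (rule poly_mapping_eqI)
  \<comment> \<open>The index set is freed from \<open>f\<close> so that the induction can run over
    it.\<close>
  have "Poly_Mapping.lookup (\<Sum>t\<in>A. Poly_Mapping.single t (Poly_Mapping.lookup f t)) s
      = (if s \<in> A then Poly_Mapping.lookup f s else 0)" if "finite A" for A s
    using that by (induction A) (auto simp: lookup_add lookup_single when_def)
  then show "Poly_Mapping.lookup
      (\<Sum>t\<in>Poly_Mapping.keys f. Poly_Mapping.single t (Poly_Mapping.lookup f t)) s
      = Poly_Mapping.lookup f s" for s
    by (simp add: in_keys_iff)
qed

text \<open>The entry at \<open>s\<close>, \<open>t\<close> sends \<open>y\<close> to the functional
  taking \<open>x\<close> to the value of \<open>d\<close> at \<open>x\<close> placed at
  \<open>t\<close> and \<open>y\<close> placed at \<open>s\<close>. Antilinearity of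
  \<open>d\<close> in its second argument matches the conjugated scalar multiplication of
  \<open>cdual\<close>, so each entry is complex linear. Positivity is inherited from
  \<open>d\<close>.\<close>

lemma ex_kernel_of_form:
  fixes K :: "'s \<Rightarrow> 's \<Rightarrow> 'e::complex_normed_vector \<Rightarrow> 'e cdual"
  assumes K: "is_kernel K" and d: "is_form d" and le: "form_le d (kernel_form K)"
  shows "\<exists>M. is_kernel M \<and> kernel_form M = d"
proof -
  let ?S = Poly_Mapping.single
  have "\<exists>C. \<forall>s t. C s t \<ge> 0 \<and>
      (\<forall>x y. cmod (d (?S t x) (?S s y)) \<le> C s t * norm x * norm y)"
    using form_le_kernel_form_bound[OF assms] by (intro choice allI) blast
  then obtain C where C: "\<And>s t. C s t \<ge> 0"
    "\<And>s t x y. cmod (d (?S t x) (?S s y)) \<le> C s t * norm x * norm y"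
    by blast
  have "\<exists>\<phi>. \<forall>x. pairing x \<phi> = d (?S t x) (?S s y)" for s t y
    using C(2)[of t _ s y]
    by (intro ex_cdual[where C = "C s t * norm y"])
      (auto simp: single_add single_scaleC form_simps[OF d] mult_ac)
  then have "\<exists>M. \<forall>s t y x. pairing x (M s t y) = d (?S t x) (?S s y)"
    by (intro choice allI)
  then obtain M where M: "\<And>s t x y. pairing x (M s t y) = d (?S t x) (?S s y)"
    by blast
  have clinear: "bounded_clinear (M s t)" for s t
    unfolding bounded_clinear_def
  proof (intro conjI allI bounded_linear_intro)
    show scaleC: "M s t (c *\<^sub>C y) = c *\<^sub>C M s t y" for c y
      by (rule cdual_eqI) (simp add: M pairing_scaleC_right single_scaleC form_simps[OF d])
    show "M s t (y + y') = M s t y + M s t y'" for y y'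
      by (rule cdual_eqI) (simp add: M pairing_add_right single_add form_simps[OF d])
    show "M s t (r *\<^sub>R y) = r *\<^sub>R M s t y" for r y
      using scaleC[of "of_real r" y] by (simp add: scaleC_of_real)
    show "norm (M s t y) \<le> norm y * C s t" for y
      using C by (intro norm_cdual_le) (auto simp: M mult_ac)
  qed
  \<comment> \<open>Both arguments are split into their one-point parts, on which \<open>M\<close>
    was defined by \<open>d\<close>.\<close>
  have "kernel_form M f g = d f g" for f g
  proof -
    have "d f g = d (\<Sum>t\<in>Poly_Mapping.keys f. ?S t (Poly_Mapping.lookup f t))
        (\<Sum>s\<in>Poly_Mapping.keys g. ?S s (Poly_Mapping.lookup g s))"
      by (simp add: sum_single_lookup)
    also have "\<dots> = kernel_form M f g"
      unfolding form_sum_right[OF d] form_sum_left[OF d] kernel_form_def M ..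
    finally show ?thesis ..
  qed
  then have "kernel_form M = d" by (intro ext)
  with clinear d show ?thesis
    unfolding is_kernel_def by (metis form_diag)
qed

section \<open>The operation D on kernels\<close>

text \<open>By \<open>form_D_le\<close> the form lies below that of \<open>K\<close>, so it comes
  from a kernel, and only from one by \<open>kernel_form_inject\<close>.\<close>

lemma kernel_D:
  assumes K: "is_kernel K" and L: "is_kernel L"
  shows is_kernel_kernel_D: "is_kernel (kernel_D L K)"
    and kernel_form_kernel_D: "kernel_form (kernel_D L K) = form_D (kernel_form L) (kernel_form K)"
proof -
  note forms = is_form_kernel_form[OF K] is_form_kernel_form[OF L]
  have "\<exists>!M. is_kernel M \<and> kernel_form M = form_D (kernel_form L) (kernel_form K)"
    using ex_kernel_of_form[OF K is_form_form_D[OF forms] form_D_le[OF forms]]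
    by (metis kernel_form_inject)
  from theI'[OF this] show "is_kernel (kernel_D L K)"
    "kernel_form (kernel_D L K) = form_D (kernel_form L) (kernel_form K)"
    unfolding kernel_D_def by auto
qed

lemma kernel_D_almost_dominated:
  assumes "is_kernel K" "is_kernel L"
  shows "kernel_almost_dominated (kernel_D L K) (kernel_D K L)"
  unfolding kernel_almost_dominated_def
  using assms
  by (simp add: is_kernel_kernel_D kernel_form_kernel_D form_D_almost_dominated
      is_form_kernel_form)

theorem corollary2p6:
  fixes K L :: "'s \<Rightarrow> 's \<Rightarrow> 'e::complex_banach \<Rightarrow> 'e cdual"
  assumes "is_kernel K" and "is_kernel L"
  shows "kernel_almost_dominated (kernel_D L K) (kernel_D K L) \<and>
         kernel_almost_dominated (kernel_D K L) (kernel_D L K)"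
  using assms by (simp add: kernel_D_almost_dominated)

end
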